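(* Let $\Psi(x)=\sum_{n\ge1}\frac{2\cos(\pi(\frac{3n-1}{4}-\frac{x}{n}))}{\sqrt n}$ for real $x$. Then \[ \int_T^{2T}|\Psi(x)|^2\,dx=T\log T+O(T),\qquad T\to\infty . \]
   Context: The series defining $\Psi$ converges for every real $x$ (conditionally). *)

theory Defs
  imports "HOL-Analysis.Analysis" "HOL-Library.Landau_Symbols"
begin

definition Psi_term :: "real \<Rightarrow> nat \<Rightarrow> real" where
  "Psi_term x n = 2 * cos (pi * ((3 * real n - 1) / 4 - x / real n)) / sqrt (real n)"

text \<open>
  The series converges only conditionally, so the sum is taken in the natural order
  of the index (limit of partial sums).  The shift by \<open>Suc\<close> makes it start at
  \<open>n = 1\<close>.
\<close>

definition Psi :: "real \<Rightarrow> real" where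
  "Psi x = (\<Sum>n. Psi_term x (Suc n))"

end

theory Submission
  imports Defs
begin

text \<open>
  For \<open>n \<ge> 3 * sqrt T\<close> and \<open>x \<in> {T..2 * T}\<close> the increments of the phase
  \<open>pi * ((3 * n - 1) / 4 - x / n)\<close> stay in \<open>[3 * pi / 4, pi]\<close> and decrease, so by the
  Kusmin--Landau argument the tail of the series from \<open>N = \<lceil>3 * sqrt T\<rceil>\<close> on is
  \<open>O(N powr (- 1/2))\<close>.  The partial sum is trivially \<open>O(sqrt N)\<close>, so replacing \<open>Psi\<close>
  by it changes the square by \<open>O(1)\<close>.  In the mean square of the partial sum the diagonal
  gives \<open>2 * T * ln N = T * ln T + O(T)\<close>.  Since \<open>1 / n - 1 / m = (m - n) / (n * m)\<close>,
  integrating the off-diagonal terms leads to sums of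
  \<open>sqrt (n * m) * sin (\<phi>\<^sub>n - \<phi>\<^sub>m) / (n - m)\<close>, which the classical Hilbert inequality
  bounds by \<open>pi * (\<Sum>n\<le>N. n) = O(T)\<close>.
\<close>

section \<open>Kusmin-Landau bound for weighted exponential sums\<close>

text \<open>
  Since \<open>cis (\<phi> n) = w n * (cis (\<phi> n) - cis (\<phi> (Suc n)))\<close> with \<open>w n = 1 / (1 - cis (\<Delta> n))\<close>,
  summation by parts leaves only the total variation of \<open>w\<close>, which monotonicity of \<open>\<Delta>\<close> controls.
\<close>

lemma norm_sum_cis_le:
  fixes \<phi> c :: "nat \<Rightarrow> real"
  defines "\<Delta> \<equiv> \<lambda>n. \<phi> (Suc n) - \<phi> n"
  assumes "N \<le> M"
    and c_nonneg: "\<And>n. n \<ge> N \<Longrightarrow> 0 \<le> c n"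
    and c_dec: "\<And>n. n \<ge> N \<Longrightarrow> c (Suc n) \<le> c n"
    and \<Delta>_dec: "\<And>n. n \<ge> N \<Longrightarrow> \<Delta> (Suc n) \<le> \<Delta> n"
    and \<Delta>_ge: "\<And>n. n \<ge> N \<Longrightarrow> pi / 3 \<le> \<Delta> n"
    and \<Delta>_le: "\<And>n. n \<ge> N \<Longrightarrow> \<Delta> n \<le> pi"
  shows "norm (\<Sum>n=N..<M. complex_of_real (c n) * cis (\<phi> n)) \<le> 6 * c N"
proof -
  define w where "w n = inverse (1 - cis (\<Delta> n))" for n
  define u where "u n = complex_of_real (c n) * w n" for n
  have ge1: "norm (1 - cis (\<Delta> n)) \<ge> 1" if "n \<ge> N" for n
  proof -
    \<comment> \<open>The lower bound \<open>pi / 3\<close> on the increments is what keeps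
      \<open>1 - cis (\<Delta> n)\<close> outside the open unit disc, so that \<open>w n\<close> has
      norm at most 1.\<close>
    have "cos (\<Delta> n) \<le> cos (pi / 3)"
      using \<Delta>_ge[OF that] \<Delta>_le[OF that] by (intro cos_monotone_0_pi_le) auto
    hence "cos (\<Delta> n) \<le> 1 / 2" by (simp add: cos_60)
    moreover have "(norm (1 - cis (\<Delta> n)))\<^sup>2 = 2 - 2 * cos (\<Delta> n)"
      using sin_cos_squared_add[of "\<Delta> n"]
      by (simp add: cmod_def power2_eq_square algebra_simps)
    ultimately have "(norm (1 - cis (\<Delta> n)))\<^sup>2 \<ge> 1\<^sup>2" by simp
    thus ?thesis by (rule power2_le_imp_le) simp
  qed
  have ne: "1 - cis (\<Delta> n) \<noteq> 0" if "n \<ge> N" for n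
    using ge1[OF that] by force
  have w_le: "norm (w n) \<le> 1" if "n \<ge> N" for n
    using ge1[OF that] by (simp add: w_def norm_inverse inverse_le_1_iff)
  have u_le: "norm (u n) \<le> c n" if "n \<ge> N" for n
    using w_le[OF that] c_nonneg[OF that]
    by (simp add: u_def norm_mult mult_left_le)
  have c_le: "c n \<le> c N" if "n \<ge> N" for n
    using that by (induction n rule: dec_induct) (auto intro: order_trans c_dec)
  have cz: "complex_of_real (c n) * cis (\<phi> n) = u n * (cis (\<phi> n) - cis (\<phi> (Suc n)))"
    if "n \<ge> N" for n
  proof -
    have "cis (\<phi> n) - cis (\<phi> (Suc n)) = (1 - cis (\<Delta> n)) * cis (\<phi> n)"
      by (simp add: \<Delta>_def algebra_simps cis_mult)
    thus ?thesis using ne[OF that] by (simp add: u_def w_def)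
  qed
  have w_diff: "norm (w (Suc n) - w n) \<le> \<Delta> n - \<Delta> (Suc n)" if "n \<ge> N" for n
  proof -
    have "w (Suc n) - w n = w (Suc n) * (cis (\<Delta> (Suc n)) - cis (\<Delta> n)) * w n"
      using ne[of n] ne[of "Suc n"] that by (simp add: w_def field_simps)
    also have "norm \<dots> \<le> norm (cis (\<Delta> (Suc n)) - cis (\<Delta> n))"
      using w_le[of n] w_le[of "Suc n"] that
      by (auto simp: norm_mult intro!: order_trans[OF mult_right_le_one_le] mult_left_le_one_le)
    \<comment> \<open>Factoring out a unimodular number leaves a chord of the unit circle, which is
      at most its arc. Hence the variation of \<open>w\<close> is bounded by that of the monotone
      \<open>\<Delta>\<close>.\<close>
    also have "cis (\<Delta> (Suc n)) - cis (\<Delta> n) = cis (\<Delta> n) * (exp (\<i> * of_real (\<Delta> (Suc n) - \<Delta> n)) - 1)"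
      by (simp add: right_diff_distrib cis_mult flip: cis_conv_exp of_real_diff)
    also have "norm \<dots> \<le> \<bar>\<Delta> (Suc n) - \<Delta> n\<bar>"
      using abs_sin_x_le_abs_x[of "(\<Delta> (Suc n) - \<Delta> n) / 2"]
      unfolding norm_mult dist_exp_i_1 by simp
    finally show ?thesis using \<Delta>_dec[OF that] by simp
  qed
  have u_diff: "norm (u (Suc n) - u n) \<le> (c n - c (Suc n)) + c N * (\<Delta> n - \<Delta> (Suc n))"
    if "n \<ge> N" for n
  proof -
    have "u (Suc n) - u n = complex_of_real (c (Suc n) - c n) * w (Suc n)
            + complex_of_real (c n) * (w (Suc n) - w n)"
      by (simp add: u_def algebra_simps)
    also have "norm \<dots> \<le> \<bar>c (Suc n) - c n\<bar> * norm (w (Suc n)) + c n * norm (w (Suc n) - w n)"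
      using c_nonneg[OF that] by (intro norm_triangle_le) (simp add: norm_mult flip: of_real_diff)
    also have "\<dots> \<le> (c n - c (Suc n)) + c N * (\<Delta> n - \<Delta> (Suc n))"
      using c_dec[OF that] w_le[of "Suc n"] w_diff[OF that] c_le[OF that] c_nonneg[of N]
        c_nonneg[OF that] that
      by (intro add_mono mult_mono) (auto simp: mult_left_le)
    finally show ?thesis .
  qed
  \<comment> \<open>Both boundary terms of the summation by parts are moved to the left, so each
    induction step adds one \<open>u_diff\<close> and the bound telescopes.\<close>
  have "norm ((\<Sum>n=N..<M. complex_of_real (c n) * cis (\<phi> n)) + u M * cis (\<phi> M) - u N * cis (\<phi> N))
          \<le> (c N - c M) + c N * (\<Delta> N - \<Delta> M)"
    using \<open>N \<le> M\<close>
  proof (induction M rule: dec_induct)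
    case (step M)
    let ?A = "(\<Sum>n=N..<M. complex_of_real (c n) * cis (\<phi> n)) + u M * cis (\<phi> M) - u N * cis (\<phi> N)"
    have "(\<Sum>n=N..<Suc M. complex_of_real (c n) * cis (\<phi> n)) + u (Suc M) * cis (\<phi> (Suc M)) - u N * cis (\<phi> N)
        = ?A + (u (Suc M) - u M) * cis (\<phi> (Suc M))"
      unfolding sum.atLeastLessThan_Suc[OF step.hyps(1)] cz[OF step.hyps(1)]
      by (simp add: algebra_simps)
    also have "norm \<dots> \<le> norm ?A + norm (u (Suc M) - u M)"
      by (rule norm_triangle_le) (simp add: norm_mult)
    also have "\<dots> \<le> (c N - c (Suc M)) + c N * (\<Delta> N - \<Delta> (Suc M))"
      using step.IH u_diff[of M] step.hyps by (simp add: algebra_simps)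
    finally show ?case .
  qed simp
  moreover have "norm x \<le> norm (x + y - z) + norm y + norm z" for x y z :: complex
    by norm
  ultimately have "norm (\<Sum>n=N..<M. complex_of_real (c n) * cis (\<phi> n))
      \<le> (c N - c M) + c N * (\<Delta> N - \<Delta> M) + norm (u M * cis (\<phi> M)) + norm (u N * cis (\<phi> N))"
    by (smt (verit, best))
  also have "\<dots> \<le> 2 * c N + c N * (\<Delta> N - \<Delta> M)"
    using u_le[of N] u_le[of M] \<open>N \<le> M\<close> by (simp add: norm_mult)
  \<comment> \<open>All increments lie in \<open>[pi / 3, pi]\<close>, so
    \<open>\<Delta> N - \<Delta> M\<close> is below 4.\<close>
  also have "\<dots> \<le> 2 * c N + c N * 4"
    using c_nonneg[of N] \<Delta>_le[of N] \<Delta>_ge[of M] \<open>N \<le> M\<close> pi_less_4 pi_ge_zero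
    by (intro add_left_mono mult_left_mono) auto
  finally show ?thesis by simp
qed

section \<open>Hilbert's inequality via the sawtooth function\<close>

text \<open>The sawtooth \<open>t - pi\<close> has Fourier coefficients proportional to
  \<open>1 / k\<close>, which produces the Hilbert kernel. For \<open>k = 0\<close> its mean value
  is 0, in agreement with \<open>x / 0 = 0\<close>.\<close>

lemma has_integral_sawtooth_mult_cos:
  "((\<lambda>t. (t - pi) * cos (of_int k * t + a)) has_integral 2 * pi * (sin a / of_int k)) {0..2 * pi}"
proof (cases "k = 0")
  case True
  have "((\<lambda>t. (t - pi) * cos a) has_integral
      ((2 * pi - pi)\<^sup>2 / 2 * cos a - (0 - pi)\<^sup>2 / 2 * cos a)) {0..2 * pi}"
    by (intro fundamental_theorem_of_calculus)
       (auto simp flip: has_real_derivative_iff_has_vector_derivative intro!: derivative_eq_intros)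
  thus ?thesis using True by (simp add: power2_eq_square)
next
  case False
  define F where "F t = (t - pi) * sin (of_int k * t + a) / of_int k + cos (of_int k * t + a) / (of_int k)\<^sup>2" for t
  have "((\<lambda>t. (t - pi) * cos (of_int k * t + a)) has_integral (F (2 * pi) - F 0)) {0..2 * pi}"
    unfolding F_def using False
    by (intro fundamental_theorem_of_calculus)
       (auto simp: field_simps power2_eq_square simp flip: has_real_derivative_iff_has_vector_derivative
          intro!: derivative_eq_intros)
  moreover have "sin (of_int k * (2 * pi) + a) = sin a" "cos (of_int k * (2 * pi) + a) = cos a"
    using sin_int_2pin[of k] cos_int_2pin[of k]
    by (simp_all add: sin_add cos_add mult_ac)
  ultimately show ?thesis using False by (simp add: F_def field_simps)
qed

lemma has_integral_cos_period:
  "((\<lambda>t. cos (of_int k * t + a)) has_integral (if k = 0 then 2 * pi * cos a else 0)) {0..2 * pi}"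
proof (cases "k = 0")
  case True
  thus ?thesis using has_integral_const_real[of "cos a" 0 "2 * pi"] by simp
next
  case False
  have "((\<lambda>t. cos (of_int k * t + a)) has_integral
      (sin (of_int k * (2 * pi) + a) / of_int k - sin (of_int k * 0 + a) / of_int k)) {0..2 * pi}"
    using False by (intro fundamental_theorem_of_calculus)
       (auto simp: field_simps simp flip: has_real_derivative_iff_has_vector_derivative
          intro!: derivative_eq_intros)
  moreover have "sin (of_int k * (2 * pi) + a) = sin a"
    using sin_int_2pin[of k] cos_int_2pin[of k]
    by (simp add: sin_add mult_ac)
  ultimately show ?thesis using False by simp
qed

text \<open>
  The diagonal terms vanish because \<open>x / 0 = 0\<close>.  Up to the factor \<open>2 * pi\<close>, the
  double sum is the integral of \<open>t - pi\<close> against \<open>F t = \<bar>\<Sum>n\<in>A. r n * cis (n * t + \<phi> n)\<bar>\<^sup>2\<close>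
  over a period, and \<open>\<bar>t - pi\<bar> \<le> pi\<close> there.
\<close>

lemma Hilbert_inequality_sin:
  fixes r \<phi> :: "nat \<Rightarrow> real"
  assumes "finite A"
  shows "\<bar>\<Sum>n\<in>A. \<Sum>m\<in>A. r n * r m * (sin (\<phi> n - \<phi> m) / (real n - real m))\<bar>
           \<le> pi * (\<Sum>n\<in>A. (r n)\<^sup>2)" (is "\<bar>?H\<bar> \<le> _")
proof -
  define k where "k n m = int n - int m" for n m
  define F where "F t = (\<Sum>n\<in>A. \<Sum>m\<in>A. r n * r m * cos (of_int (k n m) * t + (\<phi> n - \<phi> m)))" for t
  have F_eq: "F t = (\<Sum>n\<in>A. r n * cos (real n * t + \<phi> n))\<^sup>2 + (\<Sum>n\<in>A. r n * sin (real n * t + \<phi> n))\<^sup>2" for t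
  proof -
    have "cos (of_int (k n m) * t + (\<phi> n - \<phi> m)) =
        cos (real n * t + \<phi> n) * cos (real m * t + \<phi> m) + sin (real n * t + \<phi> n) * sin (real m * t + \<phi> m)" for n m
    proof -
      have "of_int (k n m) * t + (\<phi> n - \<phi> m) = (real n * t + \<phi> n) - (real m * t + \<phi> m)"
        by (simp add: k_def algebra_simps)
      thus ?thesis by (simp only: cos_diff)
    qed
    thus ?thesis
      by (simp add: F_def power2_eq_square sum_product algebra_simps sum.distrib)
  qed
  have F_nonneg: "F t \<ge> 0" for t by (simp add: F_eq)
  have saw: "((\<lambda>t. (t - pi) * F t) has_integral 2 * pi * ?H) {0..2 * pi}"
  proof -
    have "((\<lambda>t. \<Sum>n\<in>A. \<Sum>m\<in>A. r n * r m * ((t - pi) * cos (of_int (k n m) * t + (\<phi> n - \<phi> m))))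
        has_integral (\<Sum>n\<in>A. \<Sum>m\<in>A. r n * r m * (2 * pi * (sin (\<phi> n - \<phi> m) / of_int (k n m))))) {0..2 * pi}"
      by (intro has_integral_sum has_integral_mult_right has_integral_sawtooth_mult_cos assms)
    thus ?thesis by (simp add: F_def sum_distrib_left k_def mult_ac)
  qed
  have "(F has_integral 2 * pi * (\<Sum>n\<in>A. (r n)\<^sup>2)) {0..2 * pi}"
  proof -
    have "((\<lambda>t. \<Sum>n\<in>A. \<Sum>m\<in>A. r n * r m * cos (of_int (k n m) * t + (\<phi> n - \<phi> m)))
        has_integral (\<Sum>n\<in>A. \<Sum>m\<in>A. r n * r m * (if k n m = 0 then 2 * pi * cos (\<phi> n - \<phi> m) else 0))) {0..2 * pi}"
      by (intro has_integral_sum has_integral_mult_right has_integral_cos_period assms)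
    moreover have "(\<Sum>m\<in>A. r n * r m * (if k n m = 0 then 2 * pi * cos (\<phi> n - \<phi> m) else 0)) = 2 * pi * (r n)\<^sup>2"
      if "n \<in> A" for n
    proof -
      have "(\<Sum>m\<in>A. r n * r m * (if k n m = 0 then 2 * pi * cos (\<phi> n - \<phi> m) else 0)) =
            (\<Sum>m\<in>A. if n = m then 2 * pi * (r m)\<^sup>2 else 0)"
        by (intro sum.cong) (auto simp: k_def power2_eq_square)
      thus ?thesis using assms that by simp
    qed
    ultimately show ?thesis by (simp add: F_def[abs_def] sum_distrib_left)
  qed
  hence mean: "((\<lambda>t. pi * F t) has_integral pi * (2 * pi * (\<Sum>n\<in>A. (r n)\<^sup>2))) {0..2 * pi}"
    by (rule has_integral_mult_right)
  \<comment> \<open>The two integrands are \<open>t * F t\<close> here and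
    \<open>(2 * pi - t) * F t\<close> below, both nonnegative on the period. They give the two
    halves of the absolute value bound.\<close>
  have "0 \<le> pi * (2 * pi * (\<Sum>n\<in>A. (r n)\<^sup>2)) + 2 * pi * ?H"
  proof (rule has_integral_nonneg[OF has_integral_add[OF mean saw]])
    show "0 \<le> pi * F t + (t - pi) * F t" if "t \<in> {0..2 * pi}" for t
      using that F_nonneg[of t] by (simp flip: distrib_right)
  qed
  moreover have "0 \<le> pi * (2 * pi * (\<Sum>n\<in>A. (r n)\<^sup>2)) - 2 * pi * ?H"
  proof (rule has_integral_nonneg[OF has_integral_diff[OF mean saw]])
    show "0 \<le> pi * F t - (t - pi) * F t" if "t \<in> {0..2 * pi}" for t
      using that F_nonneg[of t] by (simp flip: left_diff_distrib)
  qed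
  moreover have "0 \<le> p * (2 * p * x) + 2 * p * y \<longleftrightarrow> 0 \<le> p * x + y"
    "0 \<le> p * (2 * p * x) - 2 * p * y \<longleftrightarrow> 0 \<le> p * x - y" if "p > 0" for p x y :: real
  proof -
    have "p * (2 * p * x) + 2 * p * y = (2 * p) * (p * x + y)"
      "p * (2 * p * x) - 2 * p * y = (2 * p) * (p * x - y)"
      by (simp_all add: algebra_simps)
    thus "0 \<le> p * (2 * p * x) + 2 * p * y \<longleftrightarrow> 0 \<le> p * x + y"
      "0 \<le> p * (2 * p * x) - 2 * p * y \<longleftrightarrow> 0 \<le> p * x - y"
      using that by (simp_all only: zero_le_mult_iff) auto
  qed
  ultimately show ?thesis using pi_gt_zero by (simp only: abs_le_iff) linarith
qed

section \<open>Tail bound, convergence and continuity of the series\<close>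

definition phase :: "real \<Rightarrow> nat \<Rightarrow> real" where
  "phase x n = pi * ((3 * real n - 1) / 4 - x / real n)"

lemma Psi_term_eq_phase: "Psi_term x n = 2 * cos (phase x n) / sqrt (real n)"
  by (simp add: Psi_term_def phase_def)

text \<open>The condition on \<open>N\<close> gives \<open>x / (n * (n + 1)) \<le> 1 / 4\<close>, so
  the phase increments lie between \<open>3 * pi / 4\<close> and \<open>pi\<close>. The constant 12
  is the 6 of \<open>norm_sum_cis_le\<close> times the factor 2 in \<open>Psi_term\<close>.\<close>

lemma sum_Psi_term_le:
  assumes "x \<ge> 0" "N > 0" "4 * x \<le> (real N)\<^sup>2"
  shows "\<bar>\<Sum>n=N..<M. Psi_term x n\<bar> \<le> 12 / sqrt (real N)"
proof (cases "N \<le> M")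
  case True
  have step: "phase x (Suc n) - phase x n = pi * (3 / 4 + x / (real n * (real n + 1)))"
    if "n \<ge> N" for n
  proof -
    have "x / real n - x / real (Suc n) = x / (real n * (real n + 1))"
      using that \<open>N > 0\<close> by (simp add: field_simps)
    moreover have "phase x (Suc n) - phase x n = pi * (3 / 4 + (x / real n - x / real (Suc n)))"
      by (simp add: phase_def algebra_simps add_divide_distrib diff_divide_distrib)
    ultimately show ?thesis by simp
  qed
  have frac: "x / (real n * (real n + 1)) \<le> 1 / 4" if "n \<ge> N" for n
  proof -
    have "4 * x \<le> real N * real N" using assms(3) by (simp add: power2_eq_square)
    also have "\<dots> \<le> real n * (real n + 1)" using that by (intro mult_mono) auto
    finally show ?thesis using that \<open>N > 0\<close> by (simp add: divide_le_eq)
  qed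
  have "norm (\<Sum>n=N..<M. complex_of_real (1 / sqrt (real n)) * cis (phase x n)) \<le> 6 * (1 / sqrt (real N))"
  proof (rule norm_sum_cis_le[OF True])
    fix n assume n: "N \<le> n"
    hence "n > 0" using \<open>N > 0\<close> by simp
    show "1 / sqrt (real (Suc n)) \<le> 1 / sqrt (real n)"
      using \<open>n > 0\<close> by (intro divide_left_mono) auto
    have "x / (real (Suc n) * (real (Suc n) + 1)) \<le> x / (real n * (real n + 1))"
      using \<open>n > 0\<close> \<open>x \<ge> 0\<close> by (intro divide_left_mono mult_mono) auto
    thus "phase x (Suc (Suc n)) - phase x (Suc n) \<le> phase x (Suc n) - phase x n"
      using n by (simp add: step)
    have "pi / 3 \<le> pi * (3 / 4)" by simp
    also have "\<dots> \<le> pi * (3 / 4 + x / (real n * (real n + 1)))"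
      using \<open>x \<ge> 0\<close> by (intro mult_left_mono) auto
    finally show "pi / 3 \<le> phase x (Suc n) - phase x n" using n by (simp add: step)
    have "pi * (3 / 4 + x / (real n * (real n + 1))) \<le> pi * 1"
      using frac[OF n] pi_ge_zero by (intro mult_left_mono) linarith+
    thus "phase x (Suc n) - phase x n \<le> pi" using n by (simp add: step)
  qed simp
  moreover have "(\<Sum>n=N..<M. Psi_term x n) =
      2 * Re (\<Sum>n=N..<M. complex_of_real (1 / sqrt (real n)) * cis (phase x n))"
    by (simp add: Psi_term_eq_phase sum_distrib_left)
  ultimately show ?thesis
    using abs_Re_le_cmod[of "\<Sum>n=N..<M. complex_of_real (1 / sqrt (real n)) * cis (phase x n)"]
    by simp
qed simp

lemma summable_Psi_term:
  assumes "x \<ge> 0"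
  shows "summable (Psi_term x)"
proof -
  \<comment> \<open>For \<open>m \<ge> N0\<close> this gives
    \<open>4 * x \<le> m \<le> m * m\<close>, the hypothesis of the tail bound; \<open>N1\<close>
    below makes that bound smaller than \<open>e\<close>.\<close>
  obtain N0 :: nat where N0: "real N0 \<ge> max 1 (4 * x)" using real_arch_simple by blast
  show ?thesis
    unfolding summable_Cauchy
  proof (intro allI impI)
    fix e :: real assume "e > 0"
    obtain N1 :: nat where N1: "real N1 > (12 / e)\<^sup>2" using reals_Archimedean2 by blast
    show "\<exists>N. \<forall>m\<ge>N. \<forall>n. norm (sum (Psi_term x) {m..<n}) < e"
    proof (intro exI allI impI)
      fix m n assume m: "m \<ge> max N0 N1"
      have "real N0 \<le> real m" using m by simp
      have "real m \<ge> 1" "4 * x \<le> real m" using N0 \<open>real N0 \<le> real m\<close> by auto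
      have "4 * x \<le> real m * 1" using \<open>4 * x \<le> real m\<close> by simp
      also have "\<dots> \<le> real m * real m" using \<open>real m \<ge> 1\<close> by (intro mult_left_mono) auto
      finally have "norm (sum (Psi_term x) {m..<n}) \<le> 12 / sqrt (real m)"
        using sum_Psi_term_le[OF assms, of m n] \<open>real m \<ge> 1\<close> by (simp add: power2_eq_square)
      moreover have "12 / e < sqrt (real m)"
        using N1 m by (intro real_less_rsqrt) auto
      hence "12 / sqrt (real m) < e"
        using \<open>e > 0\<close> \<open>real m \<ge> 1\<close> by (simp add: field_simps)
      ultimately show "norm (sum (Psi_term x) {m..<n}) < e" by simp
    qed
  qed
qed

text \<open>Starting at index 0 is harmless: \<open>Psi_term x 0\<close> is 0 because it divides by
  \<open>sqrt 0\<close>.\<close>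

lemma Psi_eq_suminf:
  assumes "x \<ge> 0"
  shows "Psi x = suminf (Psi_term x)"
  using suminf_split_head[OF summable_Psi_term[OF assms]] by (simp add: Psi_def Psi_term_def)

lemma Psi_minus_partial_sum_le:
  assumes "x \<ge> 0" "N > 0" "4 * x \<le> (real N)\<^sup>2"
  shows "\<bar>Psi x - (\<Sum>n<N. Psi_term x n)\<bar> \<le> 12 / sqrt (real N)"
proof (rule tendsto_upperbound)
  have "(\<lambda>M. \<Sum>n<M. Psi_term x n) \<longlonglongrightarrow> Psi x"
    using summable_LIMSEQ[OF summable_Psi_term] assms(1) by (simp add: Psi_eq_suminf)
  thus "(\<lambda>M. \<bar>(\<Sum>n<M. Psi_term x n) - (\<Sum>n<N. Psi_term x n)\<bar>) \<longlonglongrightarrow> \<bar>Psi x - (\<Sum>n<N. Psi_term x n)\<bar>"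
    by (intro tendsto_intros)
  show "\<forall>\<^sub>F M in sequentially. \<bar>(\<Sum>n<M. Psi_term x n) - (\<Sum>n<N. Psi_term x n)\<bar> \<le> 12 / sqrt (real N)"
    using eventually_ge_at_top[of N]
  proof eventually_elim
    case (elim M)
    have "(\<Sum>n<M. Psi_term x n) - (\<Sum>n<N. Psi_term x n) = (\<Sum>n=N..<M. Psi_term x n)"
      using sum_diff_nat_ivl[of 0 N M "Psi_term x"] elim by (simp add: atLeast0LessThan)
    thus ?case using sum_Psi_term_le[OF assms] by simp
  qed
qed simp

lemma continuous_on_Psi_term: "continuous_on S (\<lambda>x. Psi_term x n)"
  by (cases "n = 0") (auto simp: Psi_term_def intro!: continuous_intros)

text \<open>The tail bound does not depend on \<open>x\<close>, and its condition holds on all of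
  \<open>{a..b}\<close> once \<open>4 * b \<le> N * N\<close>, so the convergence is uniform.
  Continuity supplies the integrability of the square of \<open>Psi\<close>.\<close>

lemma continuous_on_Psi:
  assumes "a \<ge> 0"
  shows "continuous_on {a..b} Psi"
proof (rule uniform_limit_theorem)
  show "uniform_limit {a..b} (\<lambda>N x. \<Sum>n<N. Psi_term x n) Psi sequentially"
  proof (rule uniform_limitI)
    fix e :: real assume "e > 0"
    have "((\<lambda>N. 12 / sqrt (real N)) \<longlongrightarrow> 0) sequentially"
      by (intro tendsto_divide_0[OF tendsto_const] filterlim_at_top_imp_at_infinity
            filterlim_compose[OF sqrt_at_top] filterlim_real_sequentially)
    hence "\<forall>\<^sub>F N in sequentially. 12 / sqrt (real N) < e"
      using \<open>e > 0\<close> by (rule order_tendstoD)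
    moreover have "\<forall>\<^sub>F N in sequentially. 4 * b \<le> (real N)\<^sup>2"
      using filterlim_pow_at_top[OF _ filterlim_real_sequentially, of 2]
      by (simp add: filterlim_at_top)
    ultimately show "\<forall>\<^sub>F N in sequentially. \<forall>x\<in>{a..b}. dist (\<Sum>n<N. Psi_term x n) (Psi x) < e"
      using eventually_gt_at_top[of 0]
    proof eventually_elim
      case (elim N)
      show ?case
      proof
        fix x assume "x \<in> {a..b}"
        hence "\<bar>Psi x - (\<Sum>n<N. Psi_term x n)\<bar> \<le> 12 / sqrt (real N)"
          using elim assms by (intro Psi_minus_partial_sum_le) auto
        thus "dist (\<Sum>n<N. Psi_term x n) (Psi x) < e" using elim by (simp add: dist_real_def)
      qed
    qed
  qed
qed (auto intro!: always_eventually continuous_intros continuous_on_Psi_term)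

section \<open>Mean square of the partial sums\<close>

text \<open>A product of cosines splits into cosines of the difference and the sum of the phases.
  These are affine in \<open>x\<close> with slopes \<open>- pi * (m - n) / (n * m)\<close> and
  \<open>- pi * (m + n) / (n * m)\<close>, whose reciprocals yield \<open>P\<close> and
  \<open>Q\<close>.\<close>

lemma has_integral_Psi_term_mult:
  fixes a b :: real
  assumes "n > 0" "m > 0" "a \<le> b"
  defines "P \<equiv> \<lambda>x. sqrt (real n) * sqrt (real m) * (sin (phase x n - phase x m) / (real n - real m))"
    and "Q \<equiv> \<lambda>x. sqrt (real n) * sqrt (real m) * (sin (phase x n + phase x m) / (real n + real m))"
  shows "((\<lambda>x. Psi_term x n * Psi_term x m) has_integral
           (if n = m then 2 * (b - a) / real n else 0) + 2 / pi * ((P b - P a) - (Q b - Q a))) {a..b}"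
proof -
  define s where "s = sqrt (real n) * sqrt (real m)"
  have s: "s > 0" "s * s = real n * real m"
    using assms by (simp_all add: s_def algebra_simps)
  have split: "Psi_term x n * Psi_term x m =
      2 / s * cos (phase x n - phase x m) + 2 / s * cos (phase x n + phase x m)" for x
    by (simp add: Psi_term_eq_phase s_def cos_diff cos_add algebra_simps diff_divide_distrib add_divide_distrib)
  have deriv: "((\<lambda>x. phase x j) has_field_derivative (- pi / real j)) (at x within S)" for x j S
    unfolding phase_def by (cases "j = 0") (auto intro!: derivative_eq_intros simp: field_simps)
  have "((\<lambda>x. 2 / s * cos (phase x n + phase x m)) has_integral - (2 / pi) * Q b - - (2 / pi) * Q a) {a..b}"
  proof (rule fundamental_theorem_of_calculus[OF \<open>a \<le> b\<close>])
    fix x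
    have C: "- (2 / pi) * (s * (C * (- pi / real n + - pi / real m) / (real n + real m))) = 2 / s * C" for C
    proof -
      have "- pi / real n + - pi / real m = - pi * (real n + real m) / (s * s)"
        using assms by (simp add: s(2) field_simps)
      thus ?thesis using s(1) assms by simp
    qed
    have "((\<lambda>x. - (2 / pi) * Q x) has_field_derivative
        - (2 / pi) * (s * (cos (phase x n + phase x m) * (- pi / real n + - pi / real m) / (real n + real m))))
        (at x within {a..b})"
      unfolding Q_def s_def[symmetric] using assms
      by (auto intro!: derivative_eq_intros deriv)
    thus "((\<lambda>x. - (2 / pi) * Q x) has_vector_derivative 2 / s * cos (phase x n + phase x m)) (at x within {a..b})"
      unfolding C has_real_derivative_iff_has_vector_derivative .
  qed
  moreover have "((\<lambda>x. 2 / s * cos (phase x n - phase x m)) has_integral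
      (if n = m then 2 * (b - a) / real n else 0) + (2 / pi * P b - 2 / pi * P a)) {a..b}"
  \<comment> \<open>On the diagonal the difference cosine is constantly 1 and contributes the main
    term, while \<open>P\<close> vanishes because of \<open>x / 0 = 0\<close>.\<close>
  proof (cases "n = m")
    case True
    thus ?thesis using has_integral_const_real[of "2 / s" a b] assms
      by (simp add: P_def s_def algebra_simps)
  next
    case False
    have "((\<lambda>x. 2 / s * cos (phase x n - phase x m)) has_integral 2 / pi * P b - 2 / pi * P a) {a..b}"
    proof (rule fundamental_theorem_of_calculus[OF \<open>a \<le> b\<close>])
      fix x
      have C: "2 / pi * (s * (C * (- pi / real n - - pi / real m) / (real n - real m))) = 2 / s * C" for C
      proof -
        have "- pi / real n - - pi / real m = pi * (real n - real m) / (s * s)"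
          using assms by (simp add: s(2) field_simps)
        thus ?thesis using s(1) False by simp
      qed
      have "((\<lambda>x. 2 / pi * P x) has_field_derivative
          2 / pi * (s * (cos (phase x n - phase x m) * (- pi / real n - - pi / real m) / (real n - real m))))
          (at x within {a..b})"
        unfolding P_def s_def[symmetric] using False
        by (auto intro!: derivative_eq_intros deriv)
      thus "((\<lambda>x. 2 / pi * P x) has_vector_derivative 2 / s * cos (phase x n - phase x m)) (at x within {a..b})"
        unfolding C has_real_derivative_iff_has_vector_derivative .
    qed
    thus ?thesis using False by simp
  qed
  ultimately show ?thesis
    unfolding split by (rule has_integral_eq_rhs[OF has_integral_add[rotated]])
      (simp add: algebra_simps add_divide_distrib diff_divide_distrib)
qed

text \<open>The diagonal sums to the harmonic number. The difference terms \<open>P\<close> need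
  Hilbert's inequality with \<open>r n = sqrt n\<close>; the sum terms \<open>Q\<close> have no
  small denominators and are bounded term by term.\<close>

lemma mean_square_partial_sum:
  fixes a b :: real
  assumes "a \<le> b"
  shows "\<bar>integral {a..b} (\<lambda>x. (\<Sum>n\<in>{1..N}. Psi_term x n)\<^sup>2) - 2 * (b - a) * harm N\<bar> \<le> 6 * (real N)\<^sup>2"
proof -
  let ?A = "{1..N}"
  define P where "P x = (\<Sum>n\<in>?A. \<Sum>m\<in>?A. sqrt (real n) * sqrt (real m) * (sin (phase x n - phase x m) / (real n - real m)))" for x
  define Q where "Q x = (\<Sum>n\<in>?A. \<Sum>m\<in>?A. sqrt (real n) * sqrt (real m) * (sin (phase x n + phase x m) / (real n + real m)))" for x
  have "((\<lambda>x. \<Sum>n\<in>?A. \<Sum>m\<in>?A. Psi_term x n * Psi_term x m) has_integral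
     (\<Sum>n\<in>?A. \<Sum>m\<in>?A. (if n = m then 2 * (b - a) / real n else 0) + 2 / pi *
       ((sqrt (real n) * sqrt (real m) * (sin (phase b n - phase b m) / (real n - real m))
        - sqrt (real n) * sqrt (real m) * (sin (phase a n - phase a m) / (real n - real m)))
       - (sqrt (real n) * sqrt (real m) * (sin (phase b n + phase b m) / (real n + real m))
        - sqrt (real n) * sqrt (real m) * (sin (phase a n + phase a m) / (real n + real m)))))) {a..b}"
    using assms by (intro has_integral_sum has_integral_Psi_term_mult) auto
  also have "(\<lambda>x. \<Sum>n\<in>?A. \<Sum>m\<in>?A. Psi_term x n * Psi_term x m) = (\<lambda>x. (\<Sum>n\<in>?A. Psi_term x n)\<^sup>2)"
    by (simp add: power2_eq_square sum_product)
  finally have "integral {a..b} (\<lambda>x. (\<Sum>n\<in>?A. Psi_term x n)\<^sup>2) =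
      (\<Sum>n\<in>?A. \<Sum>m\<in>?A. if n = m then 2 * (b - a) / real n else 0) + 2 / pi * ((P b - P a) - (Q b - Q a))"
    by (simp only: integral_unique P_def Q_def sum.distrib sum_subtractf flip: sum_distrib_left)
  moreover have "(\<Sum>n\<in>?A. \<Sum>m\<in>?A. if n = m then 2 * (b - a) / real n else 0) = 2 * (b - a) * harm N"
    by (simp add: harm_def sum_distrib_left divide_inverse)
  ultimately have eq: "integral {a..b} (\<lambda>x. (\<Sum>n\<in>?A. Psi_term x n)\<^sup>2) - 2 * (b - a) * harm N
      = 2 / pi * ((P b - P a) - (Q b - Q a))" by simp
  have P_le: "\<bar>P x\<bar> \<le> pi * (real N)\<^sup>2" for x
  proof -
    have "\<bar>P x\<bar> \<le> pi * (\<Sum>n\<in>?A. (sqrt (real n))\<^sup>2)"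
      unfolding P_def by (rule Hilbert_inequality_sin) simp
    also have "(\<Sum>n\<in>?A. (sqrt (real n))\<^sup>2) \<le> (\<Sum>n\<in>?A. real N)" by (intro sum_mono) auto
    finally show ?thesis by (simp add: power2_eq_square)
  qed
  have Q_le: "\<bar>Q x\<bar> \<le> (real N)\<^sup>2 / 2" for x
  proof -
    have "\<bar>sqrt (real n) * sqrt (real m) * (sin (phase x n + phase x m) / (real n + real m))\<bar> \<le> 1 / 2"
      if "n \<in> ?A" "m \<in> ?A" for n m
    proof -
      \<comment> \<open>By the inequality of arithmetic and geometric means every term of
        \<open>Q\<close> is at most \<open>1 / 2\<close> in absolute value.\<close>
      have "sqrt (real n) * sqrt (real m) \<le> (real n + real m) / 2"
        using arith_geo_mean_sqrt[of "real n" "real m"] by (simp add: real_sqrt_mult)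
      hence "sqrt (real n) * sqrt (real m) * \<bar>sin (phase x n + phase x m)\<bar> \<le> (real n + real m) / 2 * 1"
        by (intro mult_mono) auto
      thus ?thesis using that by (simp add: abs_mult field_simps)
    qed
    hence "\<bar>Q x\<bar> \<le> (\<Sum>n\<in>?A. \<Sum>m\<in>?A. 1 / 2)"
      unfolding Q_def by (intro order_trans[OF sum_abs] sum_mono) auto
    thus ?thesis by (simp add: power2_eq_square)
  qed
  have "\<bar>(P b - P a) - (Q b - Q a)\<bar> \<le> 2 * pi * (real N)\<^sup>2 + (real N)\<^sup>2"
    using P_le[of a] P_le[of b] Q_le[of a] Q_le[of b] by linarith
  also have "\<dots> \<le> 3 * pi * (real N)\<^sup>2"
    using mult_right_mono[of 1 pi "(real N)\<^sup>2"] pi_gt3 by simp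
  finally have "2 / pi * \<bar>(P b - P a) - (Q b - Q a)\<bar> \<le> 2 / pi * (3 * pi * (real N)\<^sup>2)"
    by (intro mult_left_mono) auto
  thus ?thesis unfolding eq abs_mult by simp
qed

section \<open>From the partial sum to \<open>Psi\<close>\<close>

text \<open>Each term is at most \<open>2 / sqrt n\<close>, which is dominated by the telescoping
  difference \<open>4 * (sqrt n - sqrt (n - 1))\<close>.\<close>

lemma abs_partial_sum_Psi_term_le: "\<bar>\<Sum>n\<in>{1..N}. Psi_term x n\<bar> \<le> 4 * sqrt (real N)"
proof (induction N)
  case (Suc N)
  have "\<bar>Psi_term x (Suc N)\<bar> \<le> 2 / sqrt (real (Suc N))"
    by (simp add: Psi_term_eq_phase abs_mult divide_right_mono del: of_nat_Suc)
  also have "\<dots> \<le> 4 * (sqrt (real (Suc N)) - sqrt (real N))"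
  proof -
    define p q where "p = sqrt (real (Suc N))" and "q = sqrt (real N)"
    have "p * p - q * q = 1" "p > 0" "q \<ge> 0" "q \<le> p" by (simp_all add: p_def q_def)
    hence "1 = (p - q) * (p + q)" by (simp add: algebra_simps)
    also have "\<dots> \<le> (p - q) * (2 * p)" using \<open>q \<le> p\<close> by (intro mult_left_mono) auto
    finally have "2 / p \<le> 4 * (p - q)" using \<open>p > 0\<close> by (simp add: field_simps)
    thus ?thesis by (simp only: p_def q_def)
  qed
  finally show ?case using Suc by simp
qed simp

theorem theorem4p5:
  "(\<lambda>T::real. integral {T..2 * T} (\<lambda>x. \<bar>Psi x\<bar>\<^sup>2) - T * ln T) \<in> O[at_top](\<lambda>T. T)"
proof (rule bigoI)
  show "\<forall>\<^sub>F T in at_top. norm (integral {T..2 * T} (\<lambda>x. \<bar>Psi x\<bar>\<^sup>2) - T * ln T) \<le> 500 * norm (T::real)"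
    using eventually_ge_at_top[of 1]
  proof eventually_elim
    fix T :: real assume T: "T \<ge> 1"
    \<comment> \<open>The factor 3 gives \<open>N * N \<ge> 9 * T\<close>, hence at least
      \<open>4 * (2 * T)\<close>, so the tail bound applies on the whole interval
      \<open>{T..2 * T}\<close>.\<close>
    define N where "N = nat \<lceil>3 * sqrt T\<rceil>"
    have "sqrt T \<ge> 1" using T by simp
    have N: "3 * sqrt T \<le> real N" "real N \<le> 4 * sqrt T"
      using \<open>sqrt T \<ge> 1\<close> unfolding N_def by linarith+
    have "N > 0" using N(1) \<open>sqrt T \<ge> 1\<close> by linarith
    have N2: "8 * T \<le> (real N)\<^sup>2" "(real N)\<^sup>2 \<le> 16 * T"
      using power_mono[OF N(1), of 2] power_mono[OF N(2), of 2] T by (simp_all add: power_mult_distrib)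
    define S where "S x = (\<Sum>n\<in>{1..N}. Psi_term x n)" for x
    have S_cont: "continuous_on {T..2 * T} S"
      unfolding S_def by (intro continuous_intros continuous_on_Psi_term)
    have near: "\<bar>\<bar>Psi x\<bar>\<^sup>2 - (S x)\<^sup>2\<bar> \<le> 240" if "x \<in> {T..2 * T}" for x
    proof -
      define R where "R = Psi x - S x"
      have "{..<Suc N} = insert 0 {1..N}" by auto
      hence "S x = (\<Sum>n<Suc N. Psi_term x n)" by (simp add: S_def Psi_term_def del: sum.lessThan_Suc)
      moreover have "4 * x \<le> (real (Suc N))\<^sup>2"
      proof -
        have "4 * x \<le> (real N)\<^sup>2" using that N2 by simp
        also have "\<dots> \<le> (real (Suc N))\<^sup>2" by (intro power_mono) auto
        finally show ?thesis .
      qed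
      ultimately have "\<bar>R\<bar> \<le> 12 / sqrt (real (Suc N))"
        using Psi_minus_partial_sum_le[of x "Suc N"] that T by (simp only: R_def) auto
      also have "\<dots> \<le> 12 / sqrt (real N)" using \<open>N > 0\<close> by (intro divide_left_mono) auto
      finally have R: "\<bar>R\<bar> \<le> 12 / sqrt (real N)" .
      have "12 / sqrt (real N) \<le> 12" using \<open>N > 0\<close> by (simp add: divide_le_eq)
      \<comment> \<open>The difference of squares is \<open>R * (2 * S x + R)\<close>. The decay
        \<open>1 / sqrt N\<close> of \<open>R\<close> cancels the growth \<open>sqrt N\<close> of
        \<open>S x\<close>, leaving at most 96 + 144 = 240.\<close>
      have "\<bar>R * (2 * S x + R)\<bar> \<le> 12 / sqrt (real N) * (2 * (4 * sqrt (real N)) + 12)"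
        unfolding abs_mult
        using R \<open>12 / sqrt (real N) \<le> 12\<close> abs_partial_sum_Psi_term_le[of x N]
        by (intro mult_mono) (auto simp: S_def)
      also have "\<dots> = 96 + 12 * (12 / sqrt (real N))" using \<open>N > 0\<close> by (simp add: field_simps)
      also have "\<dots> \<le> 240" using \<open>12 / sqrt (real N) \<le> 12\<close> by simp
      also have "R * (2 * S x + R) = \<bar>Psi x\<bar>\<^sup>2 - (S x)\<^sup>2"
        by (simp add: R_def power2_eq_square algebra_simps)
      finally show ?thesis .
    qed
    have int: "(\<lambda>x. \<bar>Psi x\<bar>\<^sup>2) integrable_on {T..2 * T}" "(\<lambda>x. (S x)\<^sup>2) integrable_on {T..2 * T}"
      using T by (auto intro!: integrable_continuous_interval continuous_intros S_cont continuous_on_Psi)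
    have "norm (integral {T..2 * T} (\<lambda>x. \<bar>Psi x\<bar>\<^sup>2 - (S x)\<^sup>2)) \<le> integral {T..2 * T} (\<lambda>x. 240)"
      using near int by (intro integral_norm_bound_integral integrable_diff) auto
    hence "\<bar>integral {T..2 * T} (\<lambda>x. \<bar>Psi x\<bar>\<^sup>2) - integral {T..2 * T} (\<lambda>x. (S x)\<^sup>2)\<bar> \<le> 240 * T"
      using T int by (simp add: integral_diff)
    moreover have "\<bar>integral {T..2 * T} (\<lambda>x. (S x)\<^sup>2) - 2 * T * harm N\<bar> \<le> 96 * T"
      using mean_square_partial_sum[of T "2 * T" N] T N2 by (simp add: S_def)
    \<comment> \<open>Since \<open>harm N = ln N + O(1)\<close> and \<open>N\<close> is of order
      \<open>sqrt T\<close>, twice the harmonic number is \<open>ln T + O(1)\<close>; the constant 8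
      is \<open>2 * (1 + 3)\<close>, with 3 bounding \<open>ln 4\<close>.\<close>
    moreover have "\<bar>2 * T * harm N - T * ln T\<bar> \<le> 8 * T"
    proof -
      have lnT: "ln (sqrt T) = ln T / 2" using T by (simp add: ln_sqrt)
      have "ln (sqrt T) \<le> ln (real N)" using N \<open>sqrt T \<ge> 1\<close> \<open>N > 0\<close> by simp
      also have "\<dots> \<le> harm N" using ln_le_harm[of N] \<open>N > 0\<close> by (smt (verit) ln_le_cancel_iff of_nat_0_less_iff)
      finally have lower: "ln T \<le> 2 * harm N" by (simp add: lnT)
      have "harm N \<le> ln (real N) + 1"
        using euler_mascheroni_sequence_decreasing[of 1 N] \<open>N > 0\<close> by (simp add: harm_expand)
      also have "ln (real N) \<le> ln (4 * sqrt T)" using N \<open>N > 0\<close> T by simp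
      also have "\<dots> = ln 4 + ln T / 2" using T by (simp add: ln_mult lnT)
      also have "ln 4 \<le> (3 :: real)" using ln_le_minus_one[of 4] by simp
      finally have upper: "2 * harm N \<le> ln T + 8" by simp
      have "T * \<bar>2 * harm N - ln T\<bar> \<le> T * 8"
        using T lower upper by (intro mult_left_mono) auto
      thus ?thesis using T by (simp add: abs_mult_pos' algebra_simps)
    qed
    \<comment> \<open>The three errors add up to (240 + 96 + 8) \<open>* T\<close>, well below
      \<open>500 * T\<close>.\<close>
    ultimately show "norm (integral {T..2 * T} (\<lambda>x. \<bar>Psi x\<bar>\<^sup>2) - T * ln T) \<le> 500 * norm T"
      using T by (simp add: abs_le_iff)
  qed
qed

end
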